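(* Let $m\ge 2$ and $n\ge 1$ be integers. There exist $m$ vectors of real (possibly negative) weights $w^{(1)},\dots,w^{(m)}\in\mathbb{R}^n$, with $w^{(a)}=(w^{(a)}_1,\dots,w^{(a)}_n)$ and $\sum_{i=1}^n w^{(a)}_i=1$ for each $a=1,\dots,m$, such that $$c_j:=\sum_{\substack{1\le i_1,\dots,i_m\le n\\ i_1+i_2+\cdots+i_m=j}} w^{(1)}_{i_1}w^{(2)}_{i_2}\cdots w^{(m)}_{i_m}=\frac{1}{m(n-1)+1}\quad\text{for all } j=m,m+1,\dots,mn$$ (equivalently, $D=\sum_{j=m}^{mn}\left(c_j-\frac{1}{m(n-1)+1}\right)^2=0$) if and only if $n$ is odd.
   Context: Interpretation: there are $m$ dice, each with $n$ sides labelled $1,\dots,n$; $w^{(a)}_i$ is the weight assigned to side $i$ of the $a$-th die, where weights are allowed to be negative but must sum to one on each die; $c_j$ is the resulting weight of the dice sum $j$, and the uniform distribution on the sums $\{m,\dots,mn\}$ corresponds to $c_j=\frac{1}{m(n-1)+1}$ for all $j$. *)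

theory Defs
  imports Complex_Main "HOL-Library.FuncSet"
begin

text \<open>
  A family of \<open>m\<close> weight vectors in \<open>\<real>\<^sup>n\<close> is a function \<open>w\<close>, where \<open>w a i\<close> is the weight of side
  \<open>i \<in> {1..n}\<close> of die \<open>a \<in> {1..m}\<close>. Values of \<open>w\<close> outside these index ranges are irrelevant:
  none of the definitions below depends on them.
\<close>

definition weight_vectors :: "nat \<Rightarrow> nat \<Rightarrow> (nat \<Rightarrow> nat \<Rightarrow> real) \<Rightarrow> bool" where
  "weight_vectors m n w \<longleftrightarrow> (\<forall>a\<in>{1..m}. (\<Sum>i=1..n. w a i) = 1)"

text \<open>
  The index tuples \<open>(i\<^sub>1, \<dots>, i\<^sub>m)\<close> with \<open>1 \<le> i\<^sub>a \<le> n\<close> are the elements of \<open>{1..m} \<rightarrow>\<^sub>E {1..n}\<close>;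
  extensionality ensures that each tuple is counted once and that the set is finite.
\<close>

definition dice_sum_weight :: "nat \<Rightarrow> nat \<Rightarrow> (nat \<Rightarrow> nat \<Rightarrow> real) \<Rightarrow> nat \<Rightarrow> real" where
  "dice_sum_weight m n w j =
     (\<Sum>i\<in>{i \<in> {1..m} \<rightarrow>\<^sub>E {1..n}. (\<Sum>a=1..m. i a) = j}. \<Prod>a=1..m. w a (i a))"

definition discrepancy :: "nat \<Rightarrow> nat \<Rightarrow> (nat \<Rightarrow> nat \<Rightarrow> real) \<Rightarrow> real" where
  "discrepancy m n w =
     (\<Sum>j=m..m*n. (dice_sum_weight m n w j - 1 / (real m * (real n - 1) + 1))\<^sup>2)"

end

theory Submission
  imports Defs "HOL-Computational_Algebra.Fundamental_Theorem_Algebra"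
begin

text \<open>
  Encode die \<open>a\<close> by its generating polynomial \<open>P\<^sub>a = w\<^sub>1 + w\<^sub>2 x + \<dots> + w\<^sub>n x\<^bsup>n-1\<^esup>\<close>. Multiplying the
  \<open>P\<^sub>a\<close> convolves the weights, so the sums of the dice are uniformly distributed if and only if
  \<open>P\<^sub>1 \<cdots> P\<^sub>m = (1 + x + \<dots> + x\<^sup>N) / (N + 1)\<close> with \<open>N = m (n - 1)\<close>
  (lemma \<open>uniform_dice_sum_iff\<close>). The question is therefore whether \<open>1 + x + \<dots> + x\<^sup>N\<close>, a
  polynomial whose complex roots are the nontrivial \<open>(N+1)\<close>-st roots of unity, splits over the
  reals into \<open>m\<close> factors of degree at most \<open>n - 1\<close>. Since the degrees add up to \<open>N\<close>, each factor
  must have degree exactly \<open>n - 1\<close>.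

  If \<open>n\<close> is even, each factor has odd degree and hence a real root. The only candidate is \<open>-1\<close>,
  which is at most a simple root of \<open>1 + x + \<dots> + x\<^sup>N\<close>, whereas \<open>m \<ge> 2\<close> factors would make it at least a
  double one. If \<open>n\<close> is odd, \<open>N\<close> is even and there is no real root at all; the polynomial is a
  product of \<open>N/2\<close> real quadratics, which can be dealt out in \<open>m\<close> groups of \<open>(n - 1)/2\<close>
  (lemma \<open>rootless_eq_prod_equal_degree\<close>). Dividing each factor by its value at \<open>1\<close> makes
  its coefficients sum to one.

  Extracting even-degree divisors (lemma \<open>rootless_even_degree_divisor\<close>) serves both directions:
  it also yields the real root in odd degree, because a rootless polynomial of degree \<open>2k+1\<close>
  would have a divisor of degree \<open>2k\<close>, with a linear cofactor.
\<close>

section \<open>Real polynomials without real roots\<close>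

text \<open>
  Evaluating a real polynomial at a complex point is a ring homomorphism; this transfers
  division with remainder over the reals to a complex root.
\<close>

lemma poly_of_real_mult_add:
  "poly (map_poly complex_of_real (p * q + r)) z =
     poly (map_poly complex_of_real p) z * poly (map_poly complex_of_real q) z
     + poly (map_poly complex_of_real r) z"
proof -
  have add: "map_poly complex_of_real (p + q) = map_poly complex_of_real p + map_poly complex_of_real q"
    for p q by (intro poly_eqI) (simp add: coeff_map_poly)
  have mult: "map_poly complex_of_real (p * q) = map_poly complex_of_real p * map_poly complex_of_real q"
    by (intro poly_eqI) (simp add: coeff_map_poly coeff_mult)
  show ?thesis by (simp add: add mult)
qed

text \<open>
  A complex root \<open>z\<close> of \<open>p\<close> is not real, so its minimal polynomial over the reals is the
  quadratic \<open>(x - z)(x - cnj z)\<close>. The remainder of \<open>p\<close> modulo it has degree at most one and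
  vanishes at the nonreal point \<open>z\<close>, which forces it to be zero.
\<close>

lemma rootless_quadratic_divisor:
  fixes p :: "real poly"
  assumes rootless: "\<And>x. poly p x \<noteq> 0" and deg: "degree p > 0"
  shows "\<exists>d. degree d = 2 \<and> d dvd p"
proof -
  let ?c = "map_poly complex_of_real"
  have "degree (?c p) = degree p" by (intro degree_map_poly) auto
  then have "\<not> constant (poly (?c p))" using deg by (simp add: constant_degree)
  then obtain z where z: "poly (?c p) z = 0" using fundamental_theorem_of_algebra by blast
  have nonreal: "Im z \<noteq> 0"
  proof
    assume "Im z = 0"
    then have "z = of_real (Re z)" by (simp add: complex_eq_iff)
    moreover have "poly (?c p) (of_real x) = of_real (poly p x)" for x
      by (induction p) (auto simp: map_poly_pCons)
    ultimately have "complex_of_real (poly p (Re z)) = 0" using z by metis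
    then show False using rootless by simp
  qed
  define d where "d = [:(Re z)\<^sup>2 + (Im z)\<^sup>2, - 2 * Re z, 1:]"
  have deg_d: "degree d = 2" by (simp add: d_def)
  have dz: "poly (?c d) z = 0"
    by (simp add: d_def map_poly_pCons complex_eq_iff algebra_simps power2_eq_square)
  define r where "r = p mod d"
  have "degree r \<le> 1"
    using degree_mod_less[of d p] deg_d unfolding r_def by fastforce
  then have "r = [:coeff r 0, coeff r 1:]"
    by (intro poly_eqI) (auto simp: coeff_pCons coeff_eq_0 split: nat.splits)
  then obtain a b where r: "r = [:a, b:]" by blast
  have "p = (p div d) * d + r" by (simp add: r_def)
  then have "poly (?c r) z = 0" using z dz poly_of_real_mult_add[of "p div d" d r z] by simp
  then have "b * Im z = 0" "a + b * Re z = 0"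
    by (simp_all add: r map_poly_pCons complex_eq_iff algebra_simps)
  then have "r = 0" using nonreal by (simp add: r)
  then have "d dvd p" by (simp add: r_def mod_eq_0_iff_dvd)
  then show ?thesis using deg_d by blast
qed

lemma rootless_even_degree_divisor:
  fixes p :: "real poly"
  assumes "\<And>x. poly p x \<noteq> 0" and "2 * k \<le> degree p"
  shows "\<exists>d. degree d = 2 * k \<and> d dvd p"
  using assms(2)
proof (induction k)
  case 0
  show ?case by (intro exI[of _ 1]) simp
next
  case (Suc k)
  then obtain d where d: "degree d = 2 * k" "d dvd p" by auto
  then obtain q where q: "p = d * q" by (elim dvdE)
  have "p \<noteq> 0" using assms(1) by force
  then have nz: "d \<noteq> 0" "q \<noteq> 0" using q by auto
  have "degree q > 0" using Suc.prems d(1) nz by (simp add: q degree_mult_eq)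
  moreover have "poly q x \<noteq> 0" for x using assms(1)[of x] by (simp add: q)
  ultimately obtain e where e: "degree e = 2" "e dvd q" using rootless_quadratic_divisor by blast
  then have "degree (d * e) = 2 * Suc k" using nz d(1) by (subst degree_mult_eq) auto
  moreover have "d * e dvd p" using e(2) by (simp add: q)
  ultimately show ?case by blast
qed

lemma odd_degree_imp_real_root:
  fixes p :: "real poly"
  assumes "odd (degree p)"
  shows "\<exists>x. poly p x = 0"
proof (rule ccontr)
  assume "\<nexists>x. poly p x = 0"
  then have rootless: "poly p x \<noteq> 0" for x by blast
  obtain k where k: "degree p = 2 * k + 1" using assms by (elim oddE)
  then obtain d where d: "degree d = 2 * k" "d dvd p"
    using rootless_even_degree_divisor[OF rootless, of k] by auto
  then obtain q where q: "p = d * q" by (elim dvdE)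
  have "p \<noteq> 0" using k by auto
  then have "degree q = 1" using k d(1) by (auto simp: q degree_mult_eq)
  then obtain a b where ab: "q = [:a, b:]" "b \<noteq> 0" using degree1_coeffs by blast
  have "poly q (- a / b) = 0" using ab by simp
  then show False using rootless[of "- a / b"] by (simp add: q)
qed

lemma rootless_eq_prod_equal_degree:
  fixes p :: "real poly"
  assumes "\<And>x. poly p x \<noteq> 0" and "degree p = m * (2 * k)" and "m > 0"
  shows "\<exists>f. p = (\<Prod>a=1..m. f a) \<and> (\<forall>a\<in>{1..m}. degree (f a) = 2 * k)"
  using assms(3,1,2)
proof (induction m arbitrary: p rule: nat_induct_non_zero)
  case 1
  show ?case by (intro exI[of _ "\<lambda>_. p"]) (use 1 in simp)
next
  case (Suc m)
  obtain d where d: "degree d = 2 * k" "d dvd p"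
    using rootless_even_degree_divisor[OF Suc.prems(1), of k] Suc.prems(2) by auto
  then obtain q where q: "p = d * q" by (elim dvdE)
  have "p \<noteq> 0" using Suc.prems(1) by force
  then have "degree q = m * (2 * k)" using Suc.prems(2) d(1) by (auto simp: q degree_mult_eq)
  moreover have "poly q x \<noteq> 0" for x using Suc.prems(1)[of x] by (simp add: q)
  ultimately obtain f where f: "q = (\<Prod>a=1..m. f a)" "\<forall>a\<in>{1..m}. degree (f a) = 2 * k"
    using Suc.IH by blast
  have "(\<Prod>a=1..m. (f(Suc m := d)) a) = (\<Prod>a=1..m. f a)" by (intro prod.cong) auto
  then have "p = (\<Prod>a=1..Suc m. (f(Suc m := d)) a)" by (simp add: q f(1))
  moreover have "\<forall>a\<in>{1..Suc m}. degree ((f(Suc m := d)) a) = 2 * k" using f(2) d(1) by auto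
  ultimately show ?case by blast
qed

section \<open>The polynomial with all coefficients one\<close>

definition all_ones_poly :: "nat \<Rightarrow> real poly" where
  "all_ones_poly N = (\<Sum>k\<le>N. monom 1 k)"

lemma coeff_all_ones_poly: "coeff (all_ones_poly N) k = (if k \<le> N then 1 else 0)"
  by (simp add: all_ones_poly_def coeff_sum)

lemma degree_all_ones_poly: "degree (all_ones_poly N) = N"
  by (intro antisym degree_le le_degree) (auto simp: coeff_all_ones_poly)

lemma poly_all_ones_poly_1: "poly (all_ones_poly N) 1 = real N + 1"
  by (simp add: all_ones_poly_def poly_sum poly_monom)

lemma all_ones_poly_mult: "[:-1, 1:] * all_ones_poly N = monom 1 (Suc N) - 1"
  by (intro poly_eqI) (auto simp: coeff_all_ones_poly coeff_pCons split: nat.splits)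

lemma all_ones_poly_real_root:
  assumes "poly (all_ones_poly N) x = 0"
  shows "x = -1"
proof -
  have "poly ([:-1, 1:] * all_ones_poly N) x = 0" using assms by simp
  then have "x ^ Suc N = 1" unfolding all_ones_poly_mult by (simp add: poly_monom)
  then have "\<bar>x\<bar> = 1" using power_eq_1_iff[of x "Suc N"] by simp
  moreover have "x \<noteq> 1" using assms poly_all_ones_poly_1[of N] by auto
  ultimately show ?thesis by linarith
qed

lemma all_ones_poly_rootless:
  assumes "even N"
  shows "poly (all_ones_poly N) x \<noteq> 0"
proof
  assume "poly (all_ones_poly N) x = 0"
  then have "poly (all_ones_poly N) (-1) = 0" using all_ones_poly_real_root by blast
  then have "poly ([:-1, 1:] * all_ones_poly N) (-1) = 0" by simp
  then show False using assms unfolding all_ones_poly_mult by (simp add: poly_monom)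
qed

text \<open>
  A double root would be a root of the derivative of \<open>x\<^bsup>N+1\<^esup> - 1\<close>, which
  vanishes at most at \<open>0\<close>.
\<close>

lemma all_ones_poly_root_simple: "\<not> [:1, 1:] * [:1, 1:] dvd all_ones_poly N"
proof
  assume "[:1, 1:] * [:1, 1:] dvd all_ones_poly N"
  then obtain q where q: "all_ones_poly N = [:1, 1:] * ([:1, 1:] * q)"
    by (metis dvdE mult.assoc)
  have "poly (pderiv ([:-1, 1:] * all_ones_poly N)) (-1) = 0"
    unfolding q by (simp only: pderiv_mult poly_add poly_mult) simp
  then show False
    unfolding all_ones_poly_mult by (simp add: pderiv_diff pderiv_monom poly_monom pderiv_1)
qed

section \<open>Generating polynomials of dice\<close>

text \<open>
  Exponents are shifted by one (side \<open>i\<close> contributes \<open>x\<^bsup>i-1\<^esup>\<close>), so that the degree bound is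
  \<open>n - 1\<close> and the product for uniform sums carries no factor \<open>x\<^sup>m\<close>.
\<close>

definition die_poly :: "nat \<Rightarrow> (nat \<Rightarrow> real) \<Rightarrow> real poly" where
  "die_poly n v = (\<Sum>i=1..n. monom (v i) (i - 1))"

lemma degree_die_poly: "degree (die_poly n v) \<le> n - 1"
  unfolding die_poly_def
  by (intro degree_sum_le) (auto intro: order.trans[OF degree_monom_le])

lemma poly_die_poly_1: "poly (die_poly n v) 1 = (\<Sum>i=1..n. v i)"
  by (simp add: die_poly_def poly_sum poly_monom)

lemma die_poly_coeffs:
  assumes "n \<ge> 1" and "degree p \<le> n - 1"
  shows "die_poly n (\<lambda>i. coeff p (i - 1)) = p"
proof -
  have "die_poly n (\<lambda>i. coeff p (i - 1)) = (\<Sum>k\<le>n - 1. monom (coeff p k) k)"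
    unfolding die_poly_def
    by (rule sum.reindex_bij_witness[of _ Suc "\<lambda>i. i - 1"]) (use assms(1) in auto)
  also have "\<dots> = p" using assms(2) by (rule poly_as_sum_of_monoms')
  finally show ?thesis .
qed

lemma prod_monom: "(\<Prod>a\<in>A. monom (c a) (k a)) = monom (\<Prod>a\<in>A. c a) (\<Sum>a\<in>A. k a)"
  by (induction A rule: infinite_finite_induct) (auto simp: mult_monom monom_0)

text \<open>
  Multiplying generating polynomials convolves the weights. The index shift accumulates to \<open>m\<close>,
  the smallest possible sum.
\<close>

lemma coeff_prod_die_poly:
  "coeff (\<Prod>a=1..m. die_poly n (w a)) k = dice_sum_weight m n w (k + m)"
proof -
  let ?I = "{1..m} \<rightarrow>\<^sub>E {1..n}"
  have shift: "(\<Sum>a=1..m. i a - 1) + m = (\<Sum>a=1..m. i a)" if "i \<in> ?I" for i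
  proof -
    have "(\<Sum>a=1..m. i a) = (\<Sum>a=1..m. (i a - 1) + 1)"
    proof (intro sum.cong refl)
      fix a assume "a \<in> {1..m}"
      then have "i a \<in> {1..n}" using that by (rule PiE_mem[rotated])
      then show "i a = (i a - 1) + 1" by simp
    qed
    then show ?thesis by (simp only: sum.distrib) simp
  qed
  have "(\<Prod>a=1..m. die_poly n (w a)) =
      (\<Sum>i\<in>?I. monom (\<Prod>a=1..m. w a (i a)) (\<Sum>a=1..m. i a - 1))"
    unfolding die_poly_def by (subst prod_sum_PiE) (simp_all add: prod_monom)
  then have "coeff (\<Prod>a=1..m. die_poly n (w a)) k =
      (\<Sum>i\<in>?I. if (\<Sum>a=1..m. i a - 1) = k then \<Prod>a=1..m. w a (i a) else 0)"
    by (simp only: coeff_sum coeff_monom)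
  also have "\<dots> = (\<Sum>i\<in>?I. if (\<Sum>a=1..m. i a) = k + m then \<Prod>a=1..m. w a (i a) else 0)"
  proof (intro sum.cong refl if_cong)
    fix i assume "i \<in> ?I"
    from shift[OF this] show "((\<Sum>a=1..m. i a - 1) = k) = ((\<Sum>a=1..m. i a) = k + m)"
      by linarith
  qed
  also have "\<dots> = dice_sum_weight m n w (k + m)"
    unfolding dice_sum_weight_def by (intro sum.inter_filter[symmetric] finite_PiE) auto
  finally show ?thesis .
qed

lemma uniform_dice_sum_iff:
  assumes "n \<ge> 1"
  shows "(\<forall>j\<in>{m..m*n}. dice_sum_weight m n w j = 1 / (real m * (real n - 1) + 1)) \<longleftrightarrow>
    (\<Prod>a=1..m. die_poly n (w a)) =
      smult (1 / (real (m * (n - 1)) + 1)) (all_ones_poly (m * (n - 1)))"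
    (is "?uniform \<longleftrightarrow> ?P = ?S")
proof -
  define N where "N = m * (n - 1)"
  have mn: "m * n = N + m" using assms by (cases n) (auto simp: N_def)
  have c: "real m * (real n - 1) + 1 = real N + 1" using assms by (simp add: N_def of_nat_diff)
  have "degree ?P \<le> (\<Sum>a=1..m. degree (die_poly n (w a)))"
    using degree_prod_sum_le[of "{1..m}" "\<lambda>a. die_poly n (w a)"] by (simp add: o_def)
  also have "\<dots> \<le> (\<Sum>a=1..m. n - 1)" by (intro sum_mono degree_die_poly)
  finally have deg: "degree ?P \<le> N" by (simp add: N_def)
  have "?uniform \<longleftrightarrow> (\<forall>k\<le>N. dice_sum_weight m n w (k + m) = 1 / (real N + 1))"
  proof -
    have "{m..m*n} = (\<lambda>k. k + m) ` {..N}" unfolding mn atMost_atLeast0 by simp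
    then show ?thesis by (simp only: c) auto
  qed
  also have "\<dots> \<longleftrightarrow> (\<forall>k. coeff ?P k = coeff (smult (1 / (real N + 1)) (all_ones_poly N)) k)"
    using deg by (auto simp: coeff_prod_die_poly[symmetric] coeff_all_ones_poly intro: coeff_eq_0)
  finally show ?thesis by (simp add: poly_eq_iff N_def)
qed

section \<open>Which dice have uniform sums\<close>

text \<open>
  For even \<open>n\<close> two of the dice polynomials would share the root \<open>-1\<close>, which can only be a simple
  root of their product.
\<close>

lemma uniform_dice_sum_imp_odd:
  assumes m: "m \<ge> 2" and "n \<ge> 1"
    and eq: "(\<Prod>a=1..m. die_poly n (w a)) = smult c (all_ones_poly (m * (n - 1)))" and "c \<noteq> 0"
  shows "odd n"
proof
  assume "even n"
  let ?P = "\<lambda>a. die_poly n (w a)"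
  let ?S = "all_ones_poly (m * (n - 1))"
  have "poly ?S 1 \<noteq> 0" unfolding poly_all_ones_poly_1 by linarith
  then have "?S \<noteq> 0" by auto
  then have "(\<Prod>a=1..m. ?P a) \<noteq> 0" using eq \<open>c \<noteq> 0\<close> by simp
  then have nz: "?P a \<noteq> 0" if "a \<in> {1..m}" for a using that by auto
  have "(\<Sum>a=1..m. degree (?P a)) = degree (\<Prod>a=1..m. ?P a)"
    using nz by (subst degree_prod_eq_sum_degree) auto
  also have "\<dots> = (\<Sum>a=1..m. n - 1)"
    using \<open>c \<noteq> 0\<close> unfolding eq by (simp add: degree_all_ones_poly)
  finally have sum_deg: "(\<Sum>a=1..m. degree (?P a)) = (\<Sum>a=1..m. n - 1)" .
  have linear_dvd: "[:1, 1:] dvd ?P a" if a: "a \<in> {1..m}" for a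
  proof -
    have "degree (?P a) = n - 1"
      using sum_mono_inv[OF sum_deg, of a] a degree_die_poly by auto
    then have "odd (degree (?P a))" using \<open>even n\<close> \<open>n \<ge> 1\<close> by simp
    then obtain x where x: "poly (?P a) x = 0" using odd_degree_imp_real_root by blast
    then have "poly (\<Prod>a=1..m. ?P a) x = 0" using a by (auto simp: poly_prod)
    then have "x = -1" using all_ones_poly_real_root \<open>c \<noteq> 0\<close> unfolding eq by simp
    then show ?thesis using x poly_eq_0_iff_dvd[of "?P a" "-1"] by simp
  qed
  have "[:1, 1:] * [:1, 1:] dvd ?P 1 * ?P 2"
    using m by (intro mult_dvd_mono linear_dvd) auto
  also have "?P 1 * ?P 2 = prod ?P {1, 2}" by simp
  also have "\<dots> dvd (\<Prod>a=1..m. ?P a)" using m by (intro prod_dvd_prod_subset) auto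
  finally have "[:1, 1:] * [:1, 1:] dvd ?S"
    using \<open>c \<noteq> 0\<close> unfolding eq by (rule dvd_smult_cancel)
  then show False using all_ones_poly_root_simple by blast
qed

lemma exists_uniform_dice_sum_of_odd:
  assumes m: "m \<ge> 1" and n: "odd n"
  shows "\<exists>w. weight_vectors m n w \<and>
    (\<Prod>a=1..m. die_poly n (w a)) =
      smult (1 / (real (m * (n - 1)) + 1)) (all_ones_poly (m * (n - 1)))"
proof -
  define N where "N = m * (n - 1)"
  obtain k where k: "n = 2 * k + 1" using n by (elim oddE)
  have "even N" by (simp add: N_def k)
  obtain f where f: "all_ones_poly N = (\<Prod>a=1..m. f a)" "\<forall>a\<in>{1..m}. degree (f a) = 2 * k"
    using rootless_eq_prod_equal_degree[OF all_ones_poly_rootless[OF \<open>even N\<close>], of m k] m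
    by (auto simp: degree_all_ones_poly N_def k)
  have val: "(\<Prod>a=1..m. poly (f a) 1) = real N + 1"
    using poly_all_ones_poly_1[of N] by (simp add: f(1) poly_prod)
  then have nz: "poly (f a) 1 \<noteq> 0" if "a \<in> {1..m}" for a
    using that by (metis finite_atLeastAtMost of_nat_Suc of_nat_neq_0 add.commute prod_zero)
  define g where "g a = smult (1 / poly (f a) 1) (f a)" for a
  define w where "w a i = coeff (g a) (i - 1)" for a i
  have die: "die_poly n (w a) = g a" if "a \<in> {1..m}" for a
    unfolding w_def using f(2) that by (intro die_poly_coeffs) (auto simp: g_def k)
  have "weight_vectors m n w"
    unfolding weight_vectors_def poly_die_poly_1[symmetric]
    using nz by (simp add: die) (simp add: g_def)
  moreover have "(\<Prod>a=1..m. die_poly n (w a)) = smult (1 / (real N + 1)) (all_ones_poly N)"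
  proof -
    have "(\<Prod>a=1..m. die_poly n (w a)) = (\<Prod>a=1..m. g a)" by (intro prod.cong) (auto simp: die)
    also have "\<dots> = smult (\<Prod>a=1..m. 1 / poly (f a) 1) (\<Prod>a=1..m. f a)"
      unfolding g_def by (rule prod_smult)
    finally show ?thesis by (simp only: f(1) prod_dividef val prod.neutral_const)
  qed
  ultimately show ?thesis unfolding N_def by blast
qed

theorem theorem2:
  fixes m n :: nat
  assumes "m \<ge> 2" and "n \<ge> 1"
  shows "((\<exists>w. weight_vectors m n w \<and>
             (\<forall>j\<in>{m..m*n}. dice_sum_weight m n w j = 1 / (real m * (real n - 1) + 1)))
           \<longleftrightarrow> odd n) \<and>
         (\<forall>w. weight_vectors m n w \<longrightarrow>
             ((\<forall>j\<in>{m..m*n}. dice_sum_weight m n w j = 1 / (real m * (real n - 1) + 1))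
               \<longleftrightarrow> discrepancy m n w = 0))"
proof (intro conjI allI impI)
  have "1 / (real (m * (n - 1)) + 1) \<noteq> 0"
    by (metis of_nat_Suc of_nat_neq_0 add.commute divide_eq_0_iff zero_neq_one)
  then show "(\<exists>w. weight_vectors m n w \<and>
             (\<forall>j\<in>{m..m*n}. dice_sum_weight m n w j = 1 / (real m * (real n - 1) + 1)))
           \<longleftrightarrow> odd n"
    unfolding uniform_dice_sum_iff[OF assms(2)]
    using uniform_dice_sum_imp_odd[OF assms] exists_uniform_dice_sum_of_odd[of m n] assms(1)
    by (meson one_le_numeral order.trans)
  show "(\<forall>j\<in>{m..m*n}. dice_sum_weight m n w j = 1 / (real m * (real n - 1) + 1))
               \<longleftrightarrow> discrepancy m n w = 0" for w
    unfolding discrepancy_def by (simp add: sum_nonneg_eq_0_iff)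
qed

end
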